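(* Let $n\ge 1$, let $a<b$, and let $\Lambda_n=(\lambda_0,\dots,\lambda_n)\in\mathbb{R}^{n+1}$ with $\lambda_0=0$ and $\lambda_0\neq\lambda_1$. Let $B_{(\lambda_0,\dots,\lambda_n)}$ be the Bernstein exponential operator on $C[a,b]$, with knots $t_0,\dots,t_n$ and coefficients $\alpha_0,\dots,\alpha_n$. Then for every $j\in\{0,1,\dots,n\}$ and every $f\in C[a,b]$, $$\left(\frac{d}{dx}-\lambda_j\right)B_{(\lambda_0,\dots,\lambda_n)}f(x)=\sum_{k=0}^{n-1}\Delta_{\Lambda_n,\lambda_j}\left[f(t_k)\right]\cdot\alpha_k\cdot p_{\Lambda_n\setminus\lambda_j,k}(x),$$ where $$\Delta_{\Lambda_n,\lambda_j}\left[f(t_k)\right]:=d_{\Lambda_n}^{k,\lambda_j}\,f(t_k)-d_{\Lambda_n}^{k,\lambda_0}\,f(t_{k+1}).$$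
   Context: For a vector $\Lambda=(\mu_0,\dots,\mu_m)\in\mathbb{R}^{m+1}$, $E_{\Lambda}$ is the $(m+1)$-dimensional space of all $f\in C^\infty(\mathbb{R},\mathbb{C})$ with $\left(\frac{d}{dx}-\mu_0\right)\cdots\left(\frac{d}{dx}-\mu_m\right)f=0$. For $k=0,\dots,m$, $p_{\Lambda,k}$ is the unique element of $E_\Lambda$ having a zero of exact order $k$ at $a$, a zero of exact order $m-k$ at $b$, and $p_{\Lambda,k}^{(k)}(a)=1$ (it exists since the $\mu_i$ are real). $\Lambda_n\setminus\lambda_j$ denotes the vector $\Lambda_n$ with the entry $\lambda_j$ (one occurrence) deleted. Bernstein exponential operator (known result): if $\lambda_0,\dots,\lambda_n$ are real and $\lambda_0\ne\lambda_1$, there exist unique points $t_0<t_1<\dots<t_n$ in $[a,b]$ and unique positive coefficients $\alpha_0,\dots,\alpha_n$ such that the operator $B_{(\lambda_0,\dots,\lambda_n)}:C[a,b]\to E_{(\lambda_0,\dots,\lambda_n)}$, $$B_{(\lambda_0,\dots,\lambda_n)}f(x):=\sum_{k=0}^{n}\alpha_k f(t_k)\,p_{\Lambda_n,k}(x),$$ satisfies $B_{(\lambda_0,\dots,\lambda_n)}(e^{\lambda_0\cdot})(x)=e^{\lambda_0x}$ and $B_{(\lambda_0,\dots,\lambda_n)}(e^{\lambda_1\cdot})(x)=e^{\lambda_1x}$. For $k=0,\dots,n-1$ and $j\in\{0,\dots,n\}$ define $$d_{\Lambda_n}^{k,\lambda_j}:=\lim_{x\uparrow b}\frac{\frac{d}{dx}p_{\Lambda_n,k}(x)}{p_{\Lambda_n\setminus\lambda_j,k}(x)}.$$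 *)

theory Defs
  imports "HOL-Analysis.Analysis"
begin

definition vderiv :: "(real \<Rightarrow> complex) \<Rightarrow> real \<Rightarrow> complex" where
  "vderiv f = (\<lambda>x. vector_derivative f (at x))"

definition smooth_fun :: "(real \<Rightarrow> complex) \<Rightarrow> bool" where
  "smooth_fun f \<longleftrightarrow> (\<forall>k x. (vderiv ^^ k) f differentiable (at x))"

definition exp_diff :: "real \<Rightarrow> (real \<Rightarrow> complex) \<Rightarrow> real \<Rightarrow> complex" where
  "exp_diff \<mu> f = (\<lambda>x. vderiv f x - of_real \<mu> * f x)"

text \<open>A vector \<open>(\<mu>\<^sub>0, \<dots>, \<mu>\<^sub>m)\<close> is a list of length \<open>m + 1\<close>.\<close>
definition exp_space :: "real list \<Rightarrow> (real \<Rightarrow> complex) set" where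
  "exp_space \<Lambda> = {f. smooth_fun f \<and> foldr exp_diff \<Lambda> f = (\<lambda>x. 0)}"

definition zero_of_order :: "(real \<Rightarrow> complex) \<Rightarrow> real \<Rightarrow> nat \<Rightarrow> bool" where
  "zero_of_order f c k \<longleftrightarrow> (\<forall>i<k. (vderiv ^^ i) f c = 0) \<and> (vderiv ^^ k) f c \<noteq> 0"

text \<open>Meaningful for \<open>a < b\<close> and \<open>k < length \<Lambda>\<close>, where existence and uniqueness hold.\<close>
definition bernstein_basis :: "real \<Rightarrow> real \<Rightarrow> real list \<Rightarrow> nat \<Rightarrow> real \<Rightarrow> complex" where
  "bernstein_basis a b \<Lambda> k =
    (THE p. p \<in> exp_space \<Lambda> \<and> zero_of_order p a k \<and>
            zero_of_order p b (length \<Lambda> - 1 - k) \<and> (vderiv ^^ k) p a = 1)"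

definition bernstein_op ::
  "real \<Rightarrow> real \<Rightarrow> real list \<Rightarrow> (nat \<Rightarrow> real) \<Rightarrow> (nat \<Rightarrow> real) \<Rightarrow> (real \<Rightarrow> complex) \<Rightarrow> real \<Rightarrow> complex"
where
  "bernstein_op a b \<Lambda> t \<alpha> f =
    (\<lambda>x. \<Sum>k<length \<Lambda>. of_real (\<alpha> k) * f (t k) * bernstein_basis a b \<Lambda> k x)"

text \<open>
  The conditions characterising the knots \<open>t\<close> and the coefficients \<open>\<alpha>\<close> of the Bernstein
  exponential operator; only the values at indices below \<open>length \<Lambda>\<close> matter.
\<close>
definition bernstein_knots_coeffs ::
  "real \<Rightarrow> real \<Rightarrow> real list \<Rightarrow> (nat \<Rightarrow> real) \<Rightarrow> (nat \<Rightarrow> real) \<Rightarrow> bool"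
where
  "bernstein_knots_coeffs a b \<Lambda> t \<alpha> \<longleftrightarrow>
    strict_mono_on {..<length \<Lambda>} t \<and>
    (\<forall>k<length \<Lambda>. t k \<in> {a..b}) \<and>
    (\<forall>k<length \<Lambda>. \<alpha> k > 0) \<and>
    (\<forall>i\<in>{0, 1}. \<forall>x\<in>{a..b}.
       bernstein_op a b \<Lambda> t \<alpha> (\<lambda>y. of_real (exp (\<Lambda> ! i * y))) x = of_real (exp (\<Lambda> ! i * x)))"

text \<open>
  Deleting one occurrence of \<open>\<mu>\<close> is \<^const>\<open>remove1\<close>; which occurrence is deleted is
  immaterial, since \<^const>\<open>exp_space\<close> depends only on the multiset of entries.
\<close>
definition bernstein_d :: "real \<Rightarrow> real \<Rightarrow> real list \<Rightarrow> nat \<Rightarrow> real \<Rightarrow> complex" where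
  "bernstein_d a b \<Lambda> k \<mu> =
    Lim (at_left b) (\<lambda>x. vderiv (bernstein_basis a b \<Lambda> k) x
                          / bernstein_basis a b (remove1 \<mu> \<Lambda>) k x)"

definition bernstein_Delta ::
  "real \<Rightarrow> real \<Rightarrow> real list \<Rightarrow> real \<Rightarrow> (nat \<Rightarrow> real) \<Rightarrow> (real \<Rightarrow> complex) \<Rightarrow> nat \<Rightarrow> complex"
where
  "bernstein_Delta a b \<Lambda> \<mu> t f k =
    bernstein_d a b \<Lambda> k \<mu> * f (t k) - bernstein_d a b \<Lambda> k (\<Lambda> ! 0) * f (t (k + 1))"

end

theory Submission
  imports Defs
begin

text \<open>
  A nonzero element of an exponential space with \<open>m + 1\<close> real exponents has at most \<open>m\<close> zeros
  (Rolle), so \<open>p\<^bsub>\<Lambda>,k\<^esub>\<close> is unique and, for \<open>\<mu>\<close> in \<open>\<Lambda>\<close> and \<open>q\<^sub>k = p\<^bsub>\<Lambda>-\<mu>,k\<^esub>\<close>, can be constructed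
  by solving \<open>(D - \<mu>) p\<^bsub>\<Lambda>,k\<^esub> = q\<^bsub>k-1\<^esub> + c\<^sub>k q\<^sub>k\<close>. Dividing by \<open>q\<^sub>k\<close> and letting \<open>x\<close> tend to
  \<open>b\<close> identifies \<open>c\<^sub>k\<close> with the limit \<open>d\<^bsub>k,\<mu>\<^esub>\<close>. Hence \<open>(D - \<mu>) B f\<close> has the coefficients
  \<open>\<alpha>\<^sub>k d\<^bsub>k,\<mu>\<^esub> f(t\<^sub>k) + \<alpha>\<^bsub>k+1\<^esub> f(t\<^bsub>k+1\<^esub>)\<close> with respect to the \<open>q\<^sub>k\<close>. For \<open>\<mu> = 0\<close> and \<open>f = 1\<close> these vanish
  since \<open>B 1 = 1\<close>, which gives \<open>\<alpha>\<^bsub>k+1\<^esub> = - \<alpha>\<^sub>k d\<^bsub>k,0\<^esub>\<close>.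
\<close>

section \<open>Smooth functions and iterated derivatives\<close>

lemma vderivI:
  assumes "\<And>x. (f has_vector_derivative g x) (at x)"
  shows "vderiv f = g"
  using assms by (auto simp: vderiv_def intro!: vector_derivative_at)

lemma smooth_fun_hvd:
  assumes "smooth_fun f"
  shows "(f has_vector_derivative vderiv f x) (at x)"
proof -
  have "f differentiable (at x)"
    using assms by (auto simp: smooth_fun_def dest: spec[of _ 0])
  then show ?thesis
    by (simp add: vderiv_def vector_derivative_works)
qed

lemma smooth_fun_vderiv:
  assumes "smooth_fun f"
  shows "smooth_fun (vderiv f)"
  unfolding smooth_fun_def
proof (intro allI)
  fix k x
  have "(vderiv ^^ Suc k) f differentiable (at x)"
    using assms unfolding smooth_fun_def by blast
  then show "(vderiv ^^ k) (vderiv f) differentiable (at x)"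
    by (simp add: funpow_swap1)
qed

lemma smooth_funI:
  assumes "\<And>x. (f has_vector_derivative g x) (at x)" "smooth_fun g"
  shows "smooth_fun f"
  unfolding smooth_fun_def
proof (intro allI)
  fix k x
  show "(vderiv ^^ k) f differentiable (at x)"
  proof (cases k)
    case 0
    then show ?thesis using assms(1)[of x] by (auto intro: differentiableI_vector)
  next
    case (Suc l)
    then show ?thesis
      using assms(2) by (simp add: funpow_swap1 vderivI[OF assms(1)] smooth_fun_def)
  qed
qed

lemma smooth_fun_vderiv_pow: "smooth_fun f \<Longrightarrow> smooth_fun ((vderiv ^^ k) f)"
  by (induction k) (auto intro: smooth_fun_vderiv)

lemma vderiv_pow_hvd:
  "smooth_fun f \<Longrightarrow> ((vderiv ^^ k) f has_vector_derivative (vderiv ^^ Suc k) f x) (at x)"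
  using smooth_fun_hvd[OF smooth_fun_vderiv_pow] by simp

text \<open>Real-linear maps cover complex scalars as well as real and imaginary parts.\<close>

lemma vderiv_pow_linear:
  assumes "bounded_linear h" "smooth_fun f"
  shows "(vderiv ^^ k) (\<lambda>x. h (f x)) = (\<lambda>x. h ((vderiv ^^ k) f x))"
proof (induction k)
  case (Suc k)
  have "vderiv (\<lambda>x. h ((vderiv ^^ k) f x)) = (\<lambda>x. h ((vderiv ^^ Suc k) f x))"
    by (intro vderivI bounded_linear.has_vector_derivative[OF assms(1)] vderiv_pow_hvd assms(2))
  with Suc show ?case by simp
qed simp

lemma smooth_fun_linear:
  assumes "bounded_linear h" "smooth_fun f"
  shows "smooth_fun (\<lambda>x. h (f x))"
  unfolding smooth_fun_def vderiv_pow_linear[OF assms]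
  using bounded_linear.has_vector_derivative[OF assms(1) vderiv_pow_hvd[OF assms(2)]]
  by (blast intro: differentiableI_vector)

lemma vderiv_pow_add:
  assumes "smooth_fun f" "smooth_fun g"
  shows "(vderiv ^^ k) (\<lambda>x. f x + g x) = (\<lambda>x. (vderiv ^^ k) f x + (vderiv ^^ k) g x)"
proof (induction k)
  case (Suc k)
  have "vderiv (\<lambda>x. (vderiv ^^ k) f x + (vderiv ^^ k) g x) =
      (\<lambda>x. (vderiv ^^ Suc k) f x + (vderiv ^^ Suc k) g x)"
    by (intro vderivI has_vector_derivative_add vderiv_pow_hvd assms)
  with Suc show ?case by simp
qed simp

lemma smooth_fun_add:
  assumes "smooth_fun f" "smooth_fun g"
  shows "smooth_fun (\<lambda>x. f x + g x)"
  unfolding smooth_fun_def vderiv_pow_add[OF assms]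
  using has_vector_derivative_add[OF vderiv_pow_hvd[OF assms(1)] vderiv_pow_hvd[OF assms(2)]]
  by (blast intro: differentiableI_vector)

lemmas vderiv_pow_cmult = vderiv_pow_linear[OF bounded_linear_mult_right]
lemmas smooth_fun_cmult = smooth_fun_linear[OF bounded_linear_mult_right]

lemma vderiv_const: "vderiv (\<lambda>_. c) = (\<lambda>_. 0)"
  by (intro vderivI has_vector_derivative_const)

lemma vderiv_pow_zero: "(vderiv ^^ k) (\<lambda>_. 0) = (\<lambda>_. 0)"
  by (induction k) (simp_all add: vderiv_const)

lemma smooth_fun_zero: "smooth_fun (\<lambda>_. 0)"
  by (simp add: smooth_fun_def vderiv_pow_zero)

lemma smooth_fun_sum:
  assumes "\<And>i. i \<in> A \<Longrightarrow> smooth_fun (g i)"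
  shows "smooth_fun (\<lambda>x. \<Sum>i\<in>A. g i x)"
  using assms
proof (induction A rule: infinite_finite_induct)
  case (insert i A)
  then have "smooth_fun (\<lambda>x. g i x + (\<Sum>i\<in>A. g i x))"
    by (intro smooth_fun_add) auto
  with insert.hyps show ?case by simp
qed (simp_all add: smooth_fun_zero)

lemma vderiv_pow_sum:
  assumes "\<And>i. i \<in> A \<Longrightarrow> smooth_fun (g i)"
  shows "(vderiv ^^ k) (\<lambda>x. \<Sum>i\<in>A. g i x) = (\<lambda>x. \<Sum>i\<in>A. (vderiv ^^ k) (g i) x)"
  using assms
proof (induction A rule: infinite_finite_induct)
  case (insert i A)
  have "(vderiv ^^ k) (\<lambda>x. g i x + (\<Sum>i\<in>A. g i x)) =
      (\<lambda>x. (vderiv ^^ k) (g i) x + (vderiv ^^ k) (\<lambda>x. \<Sum>i\<in>A. g i x) x)"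
    by (intro vderiv_pow_add smooth_fun_sum) (use insert.prems in auto)
  with insert show ?case by simp
qed (simp_all add: vderiv_pow_zero)

section \<open>The operators \<open>D - \<mu>\<close> and exponential spaces\<close>

lemma exp_diff_conv: "exp_diff \<mu> f = (\<lambda>x. vderiv f x + (- of_real \<mu>) * f x)"
  by (simp add: exp_diff_def)

lemma smooth_fun_exp_diff: "smooth_fun f \<Longrightarrow> smooth_fun (exp_diff \<mu> f)"
  unfolding exp_diff_conv by (intro smooth_fun_add smooth_fun_cmult smooth_fun_vderiv)

lemma vderiv_pow_Suc_exp_diff:
  assumes "smooth_fun f"
  shows "(vderiv ^^ Suc k) f x =
    of_real \<mu> * (vderiv ^^ k) f x + (vderiv ^^ k) (exp_diff \<mu> f) x"
proof -
  have "(vderiv ^^ k) (exp_diff \<mu> f) =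
      (\<lambda>x. (vderiv ^^ k) (vderiv f) x + (- of_real \<mu>) * (vderiv ^^ k) f x)"
    unfolding exp_diff_conv
    using assms by (simp only: vderiv_pow_add vderiv_pow_cmult smooth_fun_cmult smooth_fun_vderiv)
  then show ?thesis
    by (simp add: funpow_swap1)
qed

lemma vderiv_eq_exp_diff: "vderiv f x = of_real \<mu> * f x + exp_diff \<mu> f x"
  by (simp add: exp_diff_def)

lemma exp_diff_zero: "exp_diff \<mu> (\<lambda>_. 0) = (\<lambda>_. 0)"
  by (simp add: exp_diff_def vderiv_const)

lemma exp_diff_linear:
  assumes "bounded_linear h" "smooth_fun f" "\<And>z. h (of_real \<mu> * z) = of_real \<mu> * h z"
  shows "exp_diff \<mu> (\<lambda>x. h (f x)) = (\<lambda>x. h (exp_diff \<mu> f x))"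
proof -
  interpret h: bounded_linear h by fact
  show ?thesis
    using vderiv_pow_linear[OF assms(1,2), of 1] assms(3) by (simp add: exp_diff_def h.diff)
qed

lemma exp_diff_cmult:
  "smooth_fun f \<Longrightarrow> exp_diff \<mu> (\<lambda>x. c * f x) = (\<lambda>x. c * exp_diff \<mu> f x)"
  by (rule exp_diff_linear[OF bounded_linear_mult_right]) simp_all

lemma exp_diff_add:
  assumes "smooth_fun f" "smooth_fun g"
  shows "exp_diff \<mu> (\<lambda>x. f x + g x) = (\<lambda>x. exp_diff \<mu> f x + exp_diff \<mu> g x)"
  using vderiv_pow_add[OF assms, of 1] by (simp add: exp_diff_def algebra_simps)

lemma exp_diff_sum:
  assumes "\<And>i. i \<in> A \<Longrightarrow> smooth_fun (g i)"
  shows "exp_diff \<mu> (\<lambda>x. \<Sum>i\<in>A. g i x) = (\<lambda>x. \<Sum>i\<in>A. exp_diff \<mu> (g i) x)"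
  using vderiv_pow_sum[of A g 1, OF assms]
  by (simp add: exp_diff_def sum_subtractf sum_distrib_left)

text \<open>Both sides equal \<open>f'' - (\<mu> + \<nu>) f' + \<mu> \<nu> f\<close>.\<close>

lemma exp_diff_commute:
  assumes "smooth_fun f"
  shows "exp_diff \<mu> (exp_diff \<nu> f) = exp_diff \<nu> (exp_diff \<mu> f)"
proof -
  have "vderiv (exp_diff \<mu> f) x = vderiv (vderiv f) x - of_real \<mu> * vderiv f x" for x \<mu>
    using vderiv_pow_Suc_exp_diff[OF assms, of 1 x \<mu>] by simp
  then show ?thesis
    by (auto simp: exp_diff_def[of \<mu> "exp_diff \<nu> f"] exp_diff_def[of \<nu> "exp_diff \<mu> f"])
       (simp add: exp_diff_def algebra_simps)
qed

section \<open>Compositions of the operators and their kernels\<close>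

lemma smooth_fun_foldr_exp_diff: "smooth_fun f \<Longrightarrow> smooth_fun (foldr exp_diff \<Lambda> f)"
  by (induction \<Lambda>) (auto intro: smooth_fun_exp_diff)

lemma foldr_exp_diff_commute:
  assumes "smooth_fun f"
  shows "foldr exp_diff \<Lambda> (exp_diff \<mu> f) = exp_diff \<mu> (foldr exp_diff \<Lambda> f)"
  by (induction \<Lambda>)
     (simp_all add: exp_diff_commute[OF smooth_fun_foldr_exp_diff[OF assms]])

text \<open>Commutation moves the factor for \<mu> to the innermost place, where
  \<open>foldr\<close> applies it first. This makes the choice of the deleted occurrence
  irrelevant.\<close>

lemma foldr_exp_diff_remove1:
  assumes "smooth_fun f" "\<mu> \<in> set \<Lambda>"
  shows "foldr exp_diff \<Lambda> f = foldr exp_diff (remove1 \<mu> \<Lambda>) (exp_diff \<mu> f)"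
  using assms(2) by (induction \<Lambda>) (auto simp: foldr_exp_diff_commute[OF assms(1)]
       exp_diff_commute[OF smooth_fun_foldr_exp_diff[OF assms(1)]])

lemma exp_space_remove1:
  assumes "\<mu> \<in> set \<Lambda>"
  shows "f \<in> exp_space \<Lambda> \<longleftrightarrow> smooth_fun f \<and> exp_diff \<mu> f \<in> exp_space (remove1 \<mu> \<Lambda>)"
  using foldr_exp_diff_remove1[OF _ assms] by (auto simp: exp_space_def smooth_fun_exp_diff)

lemma exp_space_Cons: "f \<in> exp_space (\<mu> # \<Lambda>) \<longleftrightarrow> smooth_fun f \<and> exp_diff \<mu> f \<in> exp_space \<Lambda>"
  using exp_space_remove1[of \<mu> "\<mu> # \<Lambda>" f] by simp

lemma exp_space_Nil: "exp_space [] = {\<lambda>_. 0}"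
  by (auto simp: exp_space_def smooth_fun_zero)

lemma exp_space_smooth: "f \<in> exp_space \<Lambda> \<Longrightarrow> smooth_fun f"
  by (simp add: exp_space_def)

lemma exp_space_zero: "(\<lambda>_. 0) \<in> exp_space \<Lambda>"
  by (induction \<Lambda>) (simp_all add: exp_space_Nil exp_space_Cons smooth_fun_zero exp_diff_zero)

lemma exp_space_add:
  "f \<in> exp_space \<Lambda> \<Longrightarrow> g \<in> exp_space \<Lambda> \<Longrightarrow> (\<lambda>x. f x + g x) \<in> exp_space \<Lambda>"
  by (induction \<Lambda> arbitrary: f g)
     (simp_all add: exp_space_Nil exp_space_Cons smooth_fun_add exp_diff_add)

text \<open>Such a map commutes with \<open>D - \<mu>\<close> because \<mu> is real. Taken with real
  and imaginary parts, it reduces zero counting to real-valued functions.\<close>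

lemma exp_space_linear:
  assumes "bounded_linear h" "\<And>\<mu> z. h (of_real \<mu> * z) = of_real \<mu> * h z" "f \<in> exp_space \<Lambda>"
  shows "(\<lambda>x. h (f x)) \<in> exp_space \<Lambda>"
proof -
  have "h 0 = 0"
    by (rule linear_0) (rule bounded_linear.linear[OF assms(1)])
  then show ?thesis
    using assms(3)
    by (induction \<Lambda> arbitrary: f)
       (simp_all add: exp_space_Nil exp_space_Cons smooth_fun_linear[OF assms(1)]
         exp_diff_linear[OF assms(1) _ assms(2)])
qed

lemma exp_space_cmult: "f \<in> exp_space \<Lambda> \<Longrightarrow> (\<lambda>x. c * f x) \<in> exp_space \<Lambda>"
  by (rule exp_space_linear[OF bounded_linear_mult_right]) simp_all

lemma exp_space_sum:
  assumes "\<And>i. i \<in> A \<Longrightarrow> g i \<in> exp_space \<Lambda>"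
  shows "(\<lambda>x. \<Sum>i\<in>A. g i x) \<in> exp_space \<Lambda>"
  using assms
proof (induction A rule: infinite_finite_induct)
  case (insert i A)
  then have "(\<lambda>x. g i x + (\<Sum>i\<in>A. g i x)) \<in> exp_space \<Lambda>"
    by (intro exp_space_add) auto
  with insert.hyps show ?case by simp
qed (simp_all add: exp_space_zero)

section \<open>Integrating factors and the first-order equation\<close>

lemma exp_of_real_hvd:
  "((\<lambda>x. exp (of_real (\<mu> * x)) :: complex) has_vector_derivative
    of_real \<mu> * exp (of_real (\<mu> * x))) (at x)"
proof -
  have "((\<lambda>x. exp (\<mu> * x)) has_real_derivative \<mu> * exp (\<mu> * x)) (at x)"
    by (auto intro!: derivative_eq_intros)
  from has_vector_derivative_of_real[OF this, where 'a = complex] show ?thesis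
    by (simp add: exp_of_real del: of_real_mult) simp
qed

lemma exp_mult_hvd:
  assumes "smooth_fun f"
  shows "((\<lambda>x. exp (of_real (- \<mu> * x)) * f x) has_vector_derivative
    exp (of_real (- \<mu> * x)) * exp_diff \<mu> f x) (at x)"
  using has_vector_derivative_mult[OF exp_of_real_hvd smooth_fun_hvd[OF assms], of "- \<mu>" x]
  by (simp add: exp_diff_def algebra_simps)

text \<open>The integrating factor turns the equation into \<open>(e^(-\<mu>x) f)' = 0\<close>, so
  this product is constant, and its value at \<open>c\<close> is 0.\<close>

lemma exp_diff_eq_zero_imp_zero:
  assumes "smooth_fun f" "exp_diff \<mu> f = (\<lambda>_. 0)" "f c = 0"
  shows "f = (\<lambda>_. 0)"
proof
  fix x
  have "((\<lambda>x. exp (of_real (- \<mu> * x)) * f x) has_vector_derivative 0) (at x within UNIV)" for x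
    using exp_mult_hvd[OF assms(1), of \<mu> x] by (simp add: assms(2))
  from has_vector_derivative_zero_constant[OF convex_UNIV this] obtain d
    where "\<And>x. exp (of_real (- \<mu> * x)) * f x = d" by auto
  from this[of x] this[of c] show "f x = 0"
    by (simp add: assms(3))
qed

text \<open>Variation of constants: an antiderivative of \<open>e^(-\<mu>x) q\<close>, multiplied by
  \<open>e^(\<mu>x)\<close>, solves the equation; the integration constant adjusts the value at
  \<open>c\<close>.\<close>

lemma exp_diff_solvable:
  assumes "smooth_fun q"
  obtains p where "smooth_fun p" "exp_diff \<mu> p = q" "p c = y"
proof -
  have "isCont q x" for x
    using smooth_fun_hvd[OF assms] has_vector_derivative_continuous by blast
  then have "isCont (\<lambda>x. exp (of_real (- \<mu> * x)) * q x) x" for x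
    by (intro continuous_intros)
  then obtain F where F:
    "\<And>x. (F has_vector_derivative exp (of_real (- \<mu> * x)) * q x) (at x)"
    using einterval_antiderivative[of "-\<infinity>" "\<infinity>" "\<lambda>x. exp (of_real (- \<mu> * x)) * q x"] by auto
  define p where "p = (\<lambda>x. exp (of_real (\<mu> * x)) * (F x - F c + y * exp (of_real (- \<mu> * c))))"
  have p': "(p has_vector_derivative of_real \<mu> * p x + q x) (at x)" for x
  proof -
    note exp_of_real_hvd[of \<mu> x]
    moreover have "((\<lambda>x. F x - F c + y * exp (of_real (- \<mu> * c))) has_vector_derivative
        exp (of_real (- \<mu> * x)) * q x) (at x)"
      using F[of x] by (auto intro!: derivative_eq_intros)
    ultimately have "(p has_vector_derivative
        exp (of_real (\<mu> * x)) * (exp (of_real (- \<mu> * x)) * q x) +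
        of_real \<mu> * exp (of_real (\<mu> * x)) * (F x - F c + y * exp (of_real (- \<mu> * c)))) (at x)"
      unfolding p_def by (rule has_vector_derivative_mult)
    then show ?thesis
      by (simp add: p_def mult.assoc[symmetric] exp_add[symmetric] add.commute)
  qed
  \<comment> \<open>The equation \<open>p' = \<mu> p + q\<close> keeps every derivative of
    \<open>p\<close> a multiple of \<open>p\<close> plus a smooth remainder, so differentiability of
    \<open>p\<close> alone yields smoothness.\<close>
  have powers: "\<exists>r. smooth_fun r \<and> (vderiv ^^ k) p = (\<lambda>x. of_real \<mu> ^ k * p x + r x)" for k
  proof (induction k)
    case 0
    show ?case by (intro exI[of _ "\<lambda>_. 0"]) (simp add: smooth_fun_zero)
  next
    case (Suc k)
    then obtain r where r: "smooth_fun r" "(vderiv ^^ k) p = (\<lambda>x. of_real \<mu> ^ k * p x + r x)"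
      by blast
    have "vderiv (\<lambda>x. of_real \<mu> ^ k * p x + r x) =
        (\<lambda>x. of_real \<mu> ^ k * (of_real \<mu> * p x + q x) + vderiv r x)"
      by (intro vderivI has_vector_derivative_add smooth_fun_hvd r(1)
          bounded_linear.has_vector_derivative[OF bounded_linear_mult_right] p')
    then have "(vderiv ^^ Suc k) p =
        (\<lambda>x. of_real \<mu> ^ Suc k * p x + (of_real \<mu> ^ k * q x + vderiv r x))"
      by (simp add: r(2) algebra_simps)
    moreover have "smooth_fun (\<lambda>x. of_real \<mu> ^ k * q x + vderiv r x)"
      by (intro smooth_fun_add smooth_fun_cmult smooth_fun_vderiv assms r(1))
    ultimately show ?case by blast
  qed
  have "smooth_fun p"
    unfolding smooth_fun_def
  proof (intro allI)
    fix k x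
    obtain r where r: "smooth_fun r" "(vderiv ^^ k) p = (\<lambda>x. of_real \<mu> ^ k * p x + r x)"
      using powers by blast
    show "(vderiv ^^ k) p differentiable (at x)"
      unfolding r(2)
      by (rule differentiableI_vector has_vector_derivative_add smooth_fun_hvd r(1)
          bounded_linear.has_vector_derivative[OF bounded_linear_mult_right] p')+
  qed
  moreover have "exp_diff \<mu> p = q"
    using vderivI[OF p'] by (simp add: exp_diff_def)
  moreover have "p c = y"
    by (simp add: p_def exp_add[symmetric])
  ultimately show ?thesis ..
qed

section \<open>Counting zeros\<close>

text \<open>Order at least \<open>k\<close>, in contrast to the exact order of
  \<open>zero_of_order\<close>: this notion passes to sums and multiples and admits the zero
  function.\<close>

definition vanishes :: "(real \<Rightarrow> complex) \<Rightarrow> real \<Rightarrow> nat \<Rightarrow> bool" where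
  "vanishes f c k \<longleftrightarrow> (\<forall>i<k. (vderiv ^^ i) f c = 0)"

lemma vanishes_0 [simp]: "vanishes f c 0"
  by (simp add: vanishes_def)

lemma vanishes_Suc: "vanishes f c (Suc k) \<longleftrightarrow> vanishes f c k \<and> (vderiv ^^ k) f c = 0"
  by (auto simp: vanishes_def less_Suc_eq)

lemma vanishes_mono: "vanishes f c k \<Longrightarrow> l \<le> k \<Longrightarrow> vanishes f c l"
  by (auto simp: vanishes_def)

lemma vanishes_imp_zero: "vanishes f c k \<Longrightarrow> 0 < k \<Longrightarrow> f c = 0"
  by (auto simp: vanishes_def dest: spec[of _ 0])

lemma zero_of_order_conv: "zero_of_order f c k \<longleftrightarrow> vanishes f c k \<and> (vderiv ^^ k) f c \<noteq> 0"
  by (simp add: zero_of_order_def vanishes_def)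

lemma vanishes_zero: "vanishes (\<lambda>_. 0) c k"
  by (simp add: vanishes_def vderiv_pow_zero)

lemma vanishes_add:
  assumes "smooth_fun f" "smooth_fun g" "vanishes f c k" "vanishes g c k"
  shows "vanishes (\<lambda>x. f x + g x) c k"
  using assms by (simp add: vanishes_def vderiv_pow_add)

lemma vanishes_linear:
  assumes "bounded_linear h" "smooth_fun f" "vanishes f c k"
  shows "vanishes (\<lambda>x. h (f x)) c k"
  using assms
  by (simp add: vanishes_def vderiv_pow_linear linear_0 bounded_linear.linear)

lemmas vanishes_cmult = vanishes_linear[OF bounded_linear_mult_right]

text \<open>At \<open>c\<close> the values of \<open>D^(k+1) f\<close> and
  \<open>D^k (D - \<mu>) f\<close> differ by \<open>\<mu> D^k f\<close>, which is zero once the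
  lower derivatives vanish.\<close>

lemma vanishes_exp_diff:
  assumes "smooth_fun f"
  shows "vanishes f c (Suc k) \<longleftrightarrow> f c = 0 \<and> vanishes (exp_diff \<mu> f) c k"
proof (induction k)
  case 0
  show ?case by (simp add: vanishes_Suc)
next
  case (Suc k)
  have "vanishes f c (Suc (Suc k)) \<longleftrightarrow>
      vanishes f c (Suc k) \<and> (vderiv ^^ Suc k) f c = 0"
    by (rule vanishes_Suc)
  also have "\<dots> \<longleftrightarrow> vanishes f c (Suc k) \<and> (vderiv ^^ k) (exp_diff \<mu> f) c = 0"
    using vderiv_pow_Suc_exp_diff[OF assms, of k c \<mu>] by (auto simp: vanishes_Suc)
  finally show ?case
    using Suc by (auto simp: vanishes_Suc)
qed

lemma vanishes_exp_diff_diff: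
  assumes "smooth_fun f" "vanishes f c k"
  shows "vanishes (exp_diff \<mu> f) c (k - 1)"
  using assms vanishes_exp_diff[OF assms(1)] by (cases k) auto

lemma vderiv_pow_exp_diff_vanishes:
  assumes "smooth_fun f" "vanishes f c (Suc k)"
  shows "(vderiv ^^ Suc k) f c = (vderiv ^^ k) (exp_diff \<mu> f) c"
  using assms vderiv_pow_Suc_exp_diff[OF assms(1), of k c \<mu>] by (simp add: vanishes_Suc)

text \<open>Induction adding points from left to right: the mean value theorem gives a new zero
  between the old maximum and the new point. Locating \<open>T\<close> strictly between the extreme
  points keeps the zeros distinct and, later, off the interval ends.\<close>

lemma Rolle_finite:
  fixes g g' :: "real \<Rightarrow> real"
  assumes "finite S" "S \<noteq> {}" "\<And>x. x \<in> S \<Longrightarrow> g x = 0"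
    and g': "\<And>x. (g has_real_derivative g' x) (at x)"
  shows "\<exists>T. finite T \<and> Suc (card T) = card S \<and> T \<subseteq> {Min S<..<Max S} \<and> (\<forall>x\<in>T. g' x = 0)"
  using assms(1-3)
proof (induction S rule: finite_linorder_max_induct)
  case (insert s S)
  show ?case
  proof (cases "S = {}")
    case True
    then show ?thesis by (intro exI[of _ "{}"]) auto
  next
    case False
    then obtain T where T: "finite T" "Suc (card T) = card S" "T \<subseteq> {Min S<..<Max S}"
      "\<forall>x\<in>T. g' x = 0"
      using insert by auto
    have M: "Max S \<in> S" "Min S \<in> S" "Min S \<le> Max S"
      using insert.hyps False by auto
    then have "Max S < s" using insert.hyps by auto
    moreover have "g (Max S) = g s"
      using insert.prems M by simp
    ultimately obtain z where z: "Max S < z" "z < s" "g' z = 0"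
      using MVT2[of "Max S" s g g'] g' by auto
    have "Min S < z" using M z by linarith
    with T(3) z \<open>Max S < s\<close> have "insert z T \<subseteq> {Min S<..<s}"
      by (meson greaterThanLessThan_iff insert_subset less_trans order_refl subset_iff)
    moreover have "z \<notin> T" using T(3) z by auto
    moreover have "Max (insert s S) = s" "Min (insert s S) = Min S"
      using Max_insert[OF insert.hyps(1) False, of s] Min_insert[OF insert.hyps(1) False, of s]
        M \<open>Max S < s\<close> by (simp_all add: max_def min_def)
    moreover have "s \<notin> S" using insert.hyps by auto
    ultimately show ?thesis
      using T z insert.hyps(1) by (intro exI[of _ "insert z T"] conjI) (simp_all only:, simp_all)
  qed
qed simp

text \<open>
  Rolle applied to \<open>e\<^bsup>-\<mu>x\<^esup> f\<close> shows that \<open>D - \<mu>\<close> lowers the number of zeros by at most one.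
\<close>

lemma exp_space_real_zeros:
  assumes "f \<in> exp_space \<Lambda>" "\<And>x. Im (f x) = 0" "a < b" "vanishes f a k" "vanishes f b l"
    and "finite Z" "Z \<subseteq> {a<..<b}" "\<And>z. z \<in> Z \<Longrightarrow> f z = 0" "length \<Lambda> \<le> k + l + card Z"
  shows "f = (\<lambda>_. 0)"
  using assms
proof (induction \<Lambda> arbitrary: f k l Z)
  case Nil
  then show ?case by (simp add: exp_space_Nil)
next
  case (Cons \<mu> \<Lambda>)
  define v where "v = exp_diff \<mu> f"
  have sm: "smooth_fun f" and v: "v \<in> exp_space \<Lambda>"
    using Cons.prems(1) by (auto simp: exp_space_Cons v_def)
  have hvd: "((\<lambda>x. Re (exp (of_real (- \<mu> * x)) * f x)) has_vector_derivative
      Re (exp (of_real (- \<mu> * x)) * v x)) (at x)" for x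
    unfolding v_def
    by (rule bounded_linear.has_vector_derivative[OF bounded_linear_Re exp_mult_hvd[OF sm]])
  have Re_exp: "Re (exp (of_real (- \<mu> * x)) * z) = exp (- \<mu> * x) * Re z" for x z
    unfolding exp_of_real by simp
  have imv: "Im (v x) = 0" for x
  proof -
    have "((\<lambda>x. Im (f x)) has_vector_derivative Im (vderiv f x)) (at x)"
      by (rule bounded_linear.has_vector_derivative[OF bounded_linear_Im smooth_fun_hvd[OF sm]])
    then have "Im (vderiv f x) = 0"
      using vector_derivative_unique_at[OF _ has_vector_derivative_const[of 0 "at x"]]
      by (simp add: Cons.prems(2))
    then show ?thesis by (simp add: v_def exp_diff_def Cons.prems(2))
  qed
  \<comment> \<open>An endpoint zero enters the Rolle argument as a single point; its remaining
    multiplicity \<open>k - 1\<close> or \<open>l - 1\<close> is passed on to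
    \<open>v\<close>.\<close>
  define S where "S = Z \<union> (if 0 < k then {a} else {}) \<union> (if 0 < l then {b} else {})"
  have fS: "finite S" using Cons.prems(6) by (simp add: S_def)
  have S0: "f x = 0" if "x \<in> S" for x
    using that Cons.prems(4,5,8) by (auto simp: S_def split: if_splits intro: vanishes_imp_zero)
  have "a \<notin> Z" "b \<notin> Z" "a \<noteq> b" using Cons.prems(3,7) by auto
  then have cS: "card S = card Z + (if 0 < k then 1 else 0) + (if 0 < l then 1 else 0)"
    using Cons.prems(6) by (auto simp: S_def)
  have "S \<noteq> {}"
    using Cons.prems(9) cS fS by (auto split: if_splits)
  have "S \<subseteq> {a..b}" using Cons.prems(3,7) by (auto simp: S_def split: if_splits)
  then have mm: "a \<le> Min S" "Max S \<le> b"
    using fS \<open>S \<noteq> {}\<close> by (auto simp: subset_iff)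
  from Rolle_finite[OF fS \<open>S \<noteq> {}\<close> _ hvd[unfolded has_real_derivative_iff_has_vector_derivative[symmetric]]]
  obtain T where T: "finite T" "Suc (card T) = card S" "T \<subseteq> {Min S<..<Max S}"
    "\<And>x. x \<in> T \<Longrightarrow> Re (exp (of_real (- \<mu> * x)) * v x) = 0"
    using S0 by auto
  have "v = (\<lambda>_. 0)"
  proof (rule Cons.IH[OF v imv Cons.prems(3)])
    show "vanishes v a (k - 1)" "vanishes v b (l - 1)"
      using vanishes_exp_diff_diff[OF sm] Cons.prems(4,5) by (auto simp: v_def)
    show "finite T" by fact
    show "T \<subseteq> {a<..<b}" using T(3) mm by (auto simp: subset_iff)
    show "v z = 0" if "z \<in> T" for z
      using T(4)[OF that] imv[of z] unfolding Re_exp by (simp add: complex_eq_iff)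
    \<comment> \<open>Truncated subtraction fits: \<open>k - 1\<close> plus the endpoint indicator
      is \<open>k\<close> even for \<open>k = 0\<close>, and likewise for \<open>l\<close>, so
      exactly one zero is lost.\<close>
    show "length \<Lambda> \<le> k - 1 + (l - 1) + card T"
      using T(2) cS Cons.prems(9) by (auto split: if_splits)
  qed
  moreover obtain c where "c \<in> S" using \<open>S \<noteq> {}\<close> by blast
  ultimately show ?case
    using exp_diff_eq_zero_imp_zero[OF sm, of \<mu> c] S0 by (simp add: v_def)
qed

text \<open>Real and imaginary parts, viewed as complex functions, stay in the space and share all
  zeros of \<open>f\<close>; the real case applies to each.\<close>

lemma exp_space_zeros:
  assumes f: "f \<in> exp_space \<Lambda>" and "a < b" "vanishes f a k" "vanishes f b l"
    and Z: "finite Z" "Z \<subseteq> {a<..<b}" "\<And>z. z \<in> Z \<Longrightarrow> f z = 0" "length \<Lambda> \<le> k + l + card Z"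
  shows "f = (\<lambda>_. 0)"
proof -
  have sm: "smooth_fun f" using f by (rule exp_space_smooth)
  have "(\<lambda>x. of_real (g (f x))) = (\<lambda>_. 0 :: complex)"
    if g: "bounded_linear g" "\<And>\<mu> z. g (of_real \<mu> * z) = \<mu> * g z" for g :: "complex \<Rightarrow> real"
  proof (rule exp_space_real_zeros[OF _ _ assms(2) _ _ Z(1,2) _ Z(4)])
    have h: "bounded_linear (\<lambda>z. of_real (g z) :: complex)"
      using bounded_linear_compose[OF bounded_linear_of_real g(1)] by simp
    show "(\<lambda>x. complex_of_real (g (f x))) \<in> exp_space \<Lambda>"
      by (rule exp_space_linear[OF h _ f]) (simp add: g(2))
    show "vanishes (\<lambda>x. complex_of_real (g (f x))) a k"
      "vanishes (\<lambda>x. complex_of_real (g (f x))) b l"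
      using vanishes_linear[OF h sm] assms by auto
  qed (use Z in \<open>auto simp: linear_0 bounded_linear.linear[OF g(1)]\<close>)
  from this[of Re] this[of Im] show ?thesis
    by (auto simp: bounded_linear_Re bounded_linear_Im fun_eq_iff complex_eq_iff)
qed

section \<open>Behaviour near a zero\<close>

text \<open>Induction on \<open>r\<close>: the derivative satisfies the bound with one power less,
  and the mean value inequality on the segment from \<open>b\<close> to \<open>x\<close> supplies
  the missing factor.\<close>

lemma vanishes_bound:
  assumes "smooth_fun f" "vanishes f b r"
  shows "\<exists>M. \<forall>x. \<bar>x - b\<bar> \<le> 1 \<longrightarrow> norm (f x) \<le> M * \<bar>x - b\<bar> ^ r"
  using assms
proof (induction r arbitrary: f)
  case 0
  have "continuous_on (cball b 1) f"
    using smooth_fun_hvd[OF 0(1)] has_vector_derivative_continuous continuous_at_imp_continuous_on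
    by blast
  then have "bounded (f ` cball b 1)"
    by (intro compact_imp_bounded compact_continuous_image compact_cball)
  then show ?case
    by (fastforce simp: bounded_iff dist_real_def abs_minus_commute)
next
  case (Suc r)
  have "vanishes (vderiv f) b r"
    using Suc.prems(2) vanishes_exp_diff[OF Suc.prems(1), of b r 0] by (simp add: exp_diff_def)
  then obtain M where M: "\<And>x. \<bar>x - b\<bar> \<le> 1 \<Longrightarrow> norm (vderiv f x) \<le> M * \<bar>x - b\<bar> ^ r"
    using Suc.IH[OF smooth_fun_vderiv[OF Suc.prems(1)]] by blast
  have "norm (f x) \<le> M * \<bar>x - b\<bar> ^ Suc r" if x: "\<bar>x - b\<bar> \<le> 1" for x
  proof -
    have "norm (f x - f b) \<le> (M * \<bar>x - b\<bar> ^ r) * norm (x - b)"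
    proof (rule differentiable_bound[of "closed_segment b x" f "\<lambda>y h. h *\<^sub>R vderiv f y"])
      fix y assume y: "y \<in> closed_segment b x"
      then have yb: "\<bar>y - b\<bar> \<le> \<bar>x - b\<bar>"
        by (auto simp: closed_segment_eq_real_ivl split: if_splits)
      show "(f has_derivative (\<lambda>h. h *\<^sub>R vderiv f y)) (at y within closed_segment b x)"
        using smooth_fun_hvd[OF Suc.prems(1), of y]
        by (auto simp: has_vector_derivative_def intro: has_derivative_at_withinI)
      \<comment> \<open>At distance 1 from \<open>b\<close> the bound is \<open>M\<close> itself, so
        \<open>M\<close> is nonnegative and the bound is monotone in the distance.\<close>
      have "0 \<le> M"
        using order_trans[OF norm_ge_zero M[of "b + 1"]] by simp
      then have "norm (vderiv f y) \<le> M * \<bar>x - b\<bar> ^ r"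
        using M[of y] yb x mult_left_mono[OF power_mono[OF yb, of r]] by (meson abs_ge_zero order_trans)
      then show "onorm (\<lambda>h. h *\<^sub>R vderiv f y) \<le> M * \<bar>x - b\<bar> ^ r"
        by (intro onorm_le) (simp add: mult.commute[of _ "norm _"] mult_right_mono)
    qed auto
    moreover have "f b = 0" using Suc.prems(2) by (rule vanishes_imp_zero) simp
    ultimately show ?thesis by (simp add: algebra_simps)
  qed
  then show ?case by blast
qed

text \<open>The model of a zero of exact order \<open>r\<close>, used to split off the leading term
  of a function at \<open>b\<close>.\<close>

lemma smooth_fun_power:
  fixes b :: real
  defines "P \<equiv> \<lambda>r x. of_real (x - b) ^ r :: complex"
  shows "smooth_fun (P r)" "vanishes (P r) b r" "(vderiv ^^ r) (P r) b = fact r"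
proof -
  have hvd: "(P (Suc r) has_vector_derivative of_nat (Suc r) * P r x) (at x)" for r x
  proof -
    have "((\<lambda>x. (x - b) ^ Suc r) has_real_derivative real (Suc r) * (x - b) ^ r) (at x)"
      by (rule derivative_eq_intros refl | simp)+
    from has_vector_derivative_of_real[OF this, where 'a = complex] show ?thesis
      by (simp add: P_def)
  qed
  have step: "exp_diff 0 (P (Suc r)) = (\<lambda>x. of_nat (Suc r) * P r x)" for r
    using vderivI[OF hvd] by (simp add: exp_diff_def)
  have P0: "P (Suc r) b = 0" for r by (simp add: P_def)
  show sm: "smooth_fun (P r)" for r
  proof (induction r)
    case 0
    have "smooth_fun (\<lambda>_. 1)"
      by (rule smooth_funI[OF has_vector_derivative_const smooth_fun_zero])
    then show ?case by (simp add: P_def)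
  next
    case (Suc r)
    show ?case
      by (rule smooth_funI[OF hvd smooth_fun_cmult[OF Suc]])
  qed
  have "vanishes (P r) b r \<and> (vderiv ^^ r) (P r) b = fact r"
  proof (induction r)
    case 0
    show ?case by (simp add: P_def)
  next
    case (Suc r)
    then have "vanishes (P (Suc r)) b (Suc r)"
      using vanishes_exp_diff[OF sm, of "Suc r" b r 0] P0
      by (auto simp: step intro: vanishes_cmult sm)
    moreover from this have "(vderiv ^^ Suc r) (P (Suc r)) b = fact (Suc r)"
      using vderiv_pow_exp_diff_vanishes[OF sm, of "Suc r" b r 0] Suc
      by (simp only: step) (simp add: vderiv_pow_cmult[OF sm])
    ultimately show ?case by blast
  qed
  then show "vanishes (P r) b r" "(vderiv ^^ r) (P r) b = fact r" by auto
qed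

lemma vanishes_quotient_tendsto_zero:
  assumes "smooth_fun f" "vanishes f b (Suc r)"
  shows "((\<lambda>x. f x / of_real (x - b) ^ r) \<longlongrightarrow> 0) (at b)"
proof -
  obtain M where M: "\<And>x. \<bar>x - b\<bar> \<le> 1 \<Longrightarrow> norm (f x) \<le> M * \<bar>x - b\<bar> ^ Suc r"
    using vanishes_bound[OF assms] by blast
  have "((\<lambda>x. M * \<bar>x - b\<bar>) \<longlongrightarrow> M * \<bar>b - b\<bar>) (at b)"
    by (intro tendsto_intros)
  then have lim: "((\<lambda>x. M * \<bar>x - b\<bar>) \<longlongrightarrow> 0) (at b)" by simp
  have "\<forall>\<^sub>F x in at b. norm (f x / of_real (x - b) ^ r) \<le> M * \<bar>x - b\<bar>"
    unfolding eventually_at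
  proof (intro exI[of _ 1] conjI ballI impI)
    fix x assume x: "x \<noteq> b \<and> dist x b < 1"
    then have "norm (f x) \<le> M * \<bar>x - b\<bar> ^ Suc r"
      by (intro M) (simp add: dist_real_def)
    moreover have "0 < \<bar>x - b\<bar> ^ r" using x by simp
    moreover have "norm (f x / of_real (x - b) ^ r) = norm (f x) / \<bar>x - b\<bar> ^ r"
      unfolding norm_divide norm_power norm_of_real ..
    ultimately show "norm (f x / of_real (x - b) ^ r) \<le> M * \<bar>x - b\<bar>"
      by (simp add: divide_le_eq mult.assoc)
  qed simp
  from Lim_null_comparison[OF this lim] show ?thesis .
qed

text \<open>Both functions are compared with \<open>(x - b)^r\<close>: the quotient of
  \<open>f\<close> tends to 0, that of \<open>g\<close> to a nonzero leading coefficient.\<close>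

lemma zero_of_order_ratio:
  assumes f: "smooth_fun f" "vanishes f b (Suc r)" and g: "smooth_fun g" "zero_of_order g b r"
  shows "((\<lambda>x. f x / g x) \<longlongrightarrow> 0) (at b)" "\<forall>\<^sub>F x in at b. g x \<noteq> 0"
proof -
  let ?P = "\<lambda>x. of_real (x - b) ^ r :: complex"
  \<comment> \<open>The leading Taylor coefficient of \<open>g\<close> at \<open>b\<close>;
    subtracting the corresponding term leaves \<open>h\<close> with a zero of order at least
    \<open>r + 1\<close>.\<close>
  define C where "C = (vderiv ^^ r) g b / fact r"
  have C: "C \<noteq> 0" using g(2) by (simp add: C_def zero_of_order_def)
  define h where "h = (\<lambda>x. g x + (- C) * ?P x)"
  note P = smooth_fun_power[where b = b and r = r]
  have cP: "smooth_fun (\<lambda>x. (- C) * ?P x)" "vanishes (\<lambda>x. (- C) * ?P x) b r"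
    by (intro smooth_fun_cmult vanishes_cmult P)+
  have "smooth_fun h"
    unfolding h_def by (intro smooth_fun_add g cP)
  moreover have "vanishes h b (Suc r)"
    unfolding vanishes_Suc
  proof
    show "vanishes h b r"
      unfolding h_def using g(2) by (intro vanishes_add g(1) cP) (simp add: zero_of_order_conv)
    show "(vderiv ^^ r) h b = 0"
      unfolding h_def vderiv_pow_add[OF g(1) cP(1)] vderiv_pow_cmult[OF P(1)] P(3)
      by (simp add: C_def)
  qed
  ultimately have "((\<lambda>x. h x / ?P x) \<longlongrightarrow> 0) (at b)"
    by (rule vanishes_quotient_tendsto_zero)
  then have "((\<lambda>x. h x / ?P x + C) \<longlongrightarrow> 0 + C) (at b)"
    by (intro tendsto_add tendsto_const)
  moreover have ne: "\<forall>\<^sub>F x in at b. x \<noteq> b"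
    by (simp add: eventually_at_filter)
  ultimately have gP: "((\<lambda>x. g x / ?P x) \<longlongrightarrow> C) (at b)"
    by (auto simp: h_def divide_simps elim!: Lim_transform_eventually eventually_mono)
  have "((\<lambda>x. (f x / ?P x) / (g x / ?P x)) \<longlongrightarrow> 0 / C) (at b)"
    by (intro tendsto_divide vanishes_quotient_tendsto_zero f gP C)
  then show "((\<lambda>x. f x / g x) \<longlongrightarrow> 0) (at b)"
    using ne by (auto elim!: Lim_transform_eventually eventually_mono)
  show "\<forall>\<^sub>F x in at b. g x \<noteq> 0"
    using tendsto_imp_eventually_ne[OF gP C] by eventually_elim auto
qed

section \<open>The Bernstein basis\<close>

text \<open>The condition under the definite description in \<open>bernstein_basis\<close>, named so
  that existence and uniqueness can be proved for it.\<close>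

definition bernstein_elem :: "real \<Rightarrow> real \<Rightarrow> real list \<Rightarrow> nat \<Rightarrow> (real \<Rightarrow> complex) \<Rightarrow> bool" where
  "bernstein_elem a b \<Lambda> k p \<longleftrightarrow> p \<in> exp_space \<Lambda> \<and> zero_of_order p a k \<and>
     zero_of_order p b (length \<Lambda> - 1 - k) \<and> (vderiv ^^ k) p a = 1"

section \<open>Uniqueness and existence of the basis functions\<close>

lemma exp_space_vanishes:
  assumes "a < b" "f \<in> exp_space \<Lambda>" "vanishes f a k" "vanishes f b l" "length \<Lambda> \<le> k + l"
  shows "f = (\<lambda>_. 0)"
  using exp_space_zeros[OF assms(2,1,3,4), of "{}"] assms(5) by simp

text \<open>One further vanishing derivative at \<open>b\<close> would bring the number of zeros to
  \<open>length \<Lambda>\<close> and force \<open>p = 0\<close>, against the normalisation at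
  \<open>a\<close>; so the order at \<open>b\<close> is exact.\<close>

lemma bernstein_elemI:
  assumes "a < b" "k < length \<Lambda>" "p \<in> exp_space \<Lambda>" "vanishes p a k"
    "vanishes p b (length \<Lambda> - 1 - k)" "(vderiv ^^ k) p a = 1"
  shows "bernstein_elem a b \<Lambda> k p"
proof -
  have "(vderiv ^^ (length \<Lambda> - 1 - k)) p b \<noteq> 0"
  proof
    assume "(vderiv ^^ (length \<Lambda> - 1 - k)) p b = 0"
    then have "vanishes p b (length \<Lambda> - k)"
      using assms(2,5) vanishes_Suc[of p b "length \<Lambda> - 1 - k"] by (simp add: Suc_diff_Suc)
    from exp_space_vanishes[OF assms(1,3,4) this] assms(2) have "p = (\<lambda>_. 0)" by simp
    with assms(6) show False by (simp add: vderiv_pow_zero)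
  qed
  with assms show ?thesis by (simp add: bernstein_elem_def zero_of_order_conv)
qed

text \<open>Equal normalisations raise the zero of \<open>p - q\<close> at \<open>a\<close> to order
  at least \<open>k + 1\<close>; together with those at \<open>b\<close> this makes
  \<open>length \<Lambda>\<close> zeros.\<close>

lemma bernstein_elem_unique:
  assumes "a < b" "k < length \<Lambda>" "bernstein_elem a b \<Lambda> k p" "bernstein_elem a b \<Lambda> k q"
  shows "p = q"
proof -
  let ?d = "\<lambda>x. p x + (- 1) * q x"
  have p: "p \<in> exp_space \<Lambda>" "vanishes p a k" "vanishes p b (length \<Lambda> - 1 - k)"
    "(vderiv ^^ k) p a = 1"
    and q: "q \<in> exp_space \<Lambda>" "vanishes q a k" "vanishes q b (length \<Lambda> - 1 - k)"
    "(vderiv ^^ k) q a = 1"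
    using assms by (auto simp: bernstein_elem_def zero_of_order_conv)
  note sm = exp_space_smooth[OF p(1)] exp_space_smooth[OF q(1)]
  note smq = smooth_fun_cmult[OF sm(2), of "- 1"]
  have "?d = (\<lambda>_. 0)"
  proof (rule exp_space_vanishes[OF assms(1)])
    show "?d \<in> exp_space \<Lambda>"
      by (intro exp_space_add exp_space_cmult p q)
    have "(vderiv ^^ k) ?d a = 0"
      unfolding vderiv_pow_add[OF sm(1) smq] vderiv_pow_cmult[OF sm(2)] by (simp add: p q)
    moreover have "vanishes ?d a k"
      by (intro vanishes_add vanishes_cmult p q sm smq)
    ultimately show "vanishes ?d a (Suc k)" by (simp add: vanishes_Suc)
    show "vanishes ?d b (length \<Lambda> - 1 - k)"
      by (intro vanishes_add vanishes_cmult p q sm smq)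
  qed (use assms(2) in simp)
  then show ?thesis by (auto simp: fun_eq_iff)
qed

lemma bernstein_basis_eq:
  assumes "a < b" "k < length \<Lambda>" "bernstein_elem a b \<Lambda> k p"
  shows "bernstein_basis a b \<Lambda> k = p"
  unfolding bernstein_basis_def bernstein_elem_def[symmetric]
  using assms bernstein_elem_unique by (intro the_equality) blast+

text \<open>
  Solving \<open>(D - \<mu>) p = q\<^bsub>k-1\<^esub> + c q\<^sub>k\<close> with the correct value at \<open>a\<close>, the constant \<open>c\<close> being
  chosen such that \<open>p(b) = 0\<close>.
\<close>

lemma bernstein_elem_step:
  fixes a b \<mu> :: real and \<Lambda> :: "real list"
  defines "\<Lambda>' \<equiv> remove1 \<mu> \<Lambda>"
  assumes ab: "a < b" and \<mu>: "\<mu> \<in> set \<Lambda>" and k: "k < length \<Lambda>"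
    and q: "\<And>i. Suc i < length \<Lambda> \<Longrightarrow> bernstein_elem a b \<Lambda>' i (q i)"
  shows "\<exists>p c. bernstein_elem a b \<Lambda> k p \<and>
    exp_diff \<mu> p = (\<lambda>x. (if k = 0 then 0 else q (k - 1) x) +
      (if Suc k < length \<Lambda> then c * q k x else 0))"
proof -
  define m where "m = length \<Lambda> - 1"
  have len: "length \<Lambda> = Suc m" "length \<Lambda>' = m"
    using k \<mu> by (auto simp: m_def \<Lambda>'_def length_remove1)
  have q': "q i \<in> exp_space \<Lambda>'" "vanishes (q i) a i" "vanishes (q i) b (m - 1 - i)"
    "(vderiv ^^ i) (q i) a = 1" if "i < m" for i
    using q[of i] that by (auto simp: bernstein_elem_def zero_of_order_conv len)
  define Q where "Q = (if k = 0 then (\<lambda>_. 0) else q (k - 1))"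
  \<comment> \<open>At \<open>b\<close>, \<open>q (k - 1)\<close> has order
    \<open>(m - 1) - (k - 1) = m - k\<close>, one more than \<open>q k\<close>.\<close>
  have Q: "Q \<in> exp_space \<Lambda>'" "vanishes Q b (m - k)" "vanishes Q a (k - 1)"
    using q'[of "k - 1"] k by (auto simp: Q_def len exp_space_zero vanishes_zero)
  \<comment> \<open>For \<open>k = 0\<close> the normalisation at \<open>a\<close> is the value
    itself; for \<open>k > 0\<close> the value 0 lets \<open>p1\<close> inherit order and
    normalisation from \<open>q (k - 1)\<close>, one derivative higher.\<close>
  obtain p1 where p1: "smooth_fun p1" "exp_diff \<mu> p1 = Q" "p1 a = (if k = 0 then 1 else 0)"
    using exp_diff_solvable[OF exp_space_smooth[OF Q(1)]] by metis
  have p1E: "p1 \<in> exp_space \<Lambda>"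
    unfolding exp_space_remove1[OF \<mu>] using p1 Q(1) by (simp add: \<Lambda>'_def)
  have p1a: "vanishes p1 a k"
  proof (cases k)
    case (Suc i)
    then show ?thesis using vanishes_exp_diff[OF p1(1), of a i \<mu>] p1 Q by simp
  qed simp
  have p1k: "(vderiv ^^ k) p1 a = 1"
  proof (cases k)
    case 0
    then show ?thesis using p1 by simp
  next
    case (Suc i)
    then show ?thesis
      using vderiv_pow_exp_diff_vanishes[OF p1(1), of a i \<mu>] p1a p1(2) q'(4)[of i] k
      by (simp add: Q_def len)
  qed
  show ?thesis
  proof (cases "k < m")
    \<comment> \<open>Here \<open>k = m\<close>: no zero is required at \<open>b\<close>, so
      \<open>p1\<close> needs no correction.\<close>
    case False
    then have "bernstein_elem a b \<Lambda> k p1"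
      using k by (intro bernstein_elemI ab p1E p1a p1k) (auto simp: len)
    moreover have "exp_diff \<mu> p1 = (\<lambda>x. if k = 0 then 0 else q (k - 1) x)"
      by (auto simp: p1(2) Q_def)
    ultimately show ?thesis
      using False by (intro exI[of _ p1] exI[of _ 0]) (simp add: len)
  next
    case True
    note qk = q'[OF True]
    obtain p2 where p2: "smooth_fun p2" "exp_diff \<mu> p2 = q k" "p2 a = 0"
      using exp_diff_solvable[OF exp_space_smooth[OF qk(1)]] by metis
    have p2E: "p2 \<in> exp_space \<Lambda>"
      unfolding exp_space_remove1[OF \<mu>] using p2 qk(1) by (simp add: \<Lambda>'_def)
    have p2a: "vanishes p2 a (Suc k)"
      using vanishes_exp_diff[OF p2(1), of a k \<mu>] p2 qk by simp
    have mk: "Suc (m - 1 - k) = m - k" using True by simp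
    \<comment> \<open>Otherwise \<open>p2\<close> would have order \<open>k + 1\<close> at
      \<open>a\<close> and \<open>m - k\<close> at \<open>b\<close>, hence \<open>m + 1\<close>
      zeros, which forces \<open>p2 = 0\<close> and \<open>q k = 0\<close>.\<close>
    have "p2 b \<noteq> 0"
    proof
      assume "p2 b = 0"
      then have "vanishes p2 b (m - k)"
        using vanishes_exp_diff[OF p2(1), of b "m - 1 - k" \<mu>] p2(2) qk(3) mk by simp
      from exp_space_vanishes[OF ab p2E p2a this] have "p2 = (\<lambda>_. 0)"
        using True by (simp add: len)
      then have "q k = (\<lambda>_. 0)" using p2(2) by (simp add: exp_diff_zero)
      with qk(4) show False by (simp add: vderiv_pow_zero)
    qed
    define c where "c = - p1 b / p2 b"
    define p where "p = (\<lambda>x. p1 x + c * p2 x)"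
    note smc = smooth_fun_cmult[OF p2(1), of c]
    have smp: "smooth_fun p" unfolding p_def by (intro smooth_fun_add p1 smc)
    have dp: "exp_diff \<mu> p = (\<lambda>x. Q x + c * q k x)"
      unfolding p_def exp_diff_add[OF p1(1) smc] exp_diff_cmult[OF p2(1)] p1(2) p2(2) ..
    have "bernstein_elem a b \<Lambda> k p"
    proof (rule bernstein_elemI[OF ab k])
      show "p \<in> exp_space \<Lambda>"
        unfolding p_def by (intro exp_space_add exp_space_cmult p1E p2E)
      have "vanishes p2 a k" using p2a by (simp add: vanishes_Suc)
      then show "vanishes p a k"
        unfolding p_def by (intro vanishes_add vanishes_cmult p1 p2 smc p1a)
      show "(vderiv ^^ k) p a = 1"
        unfolding p_def vderiv_pow_add[OF p1(1) smc] vderiv_pow_cmult[OF p2(1)]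
        using p1k p2a by (simp add: vanishes_Suc)
      have "p b = 0" using \<open>p2 b \<noteq> 0\<close> by (simp add: p_def c_def)
      moreover have "vanishes (exp_diff \<mu> p) b (m - 1 - k)"
        unfolding dp
        by (intro vanishes_add vanishes_cmult smooth_fun_cmult exp_space_smooth[OF Q(1)]
            exp_space_smooth[OF qk(1)] qk(3) vanishes_mono[OF Q(2)]) simp
      ultimately show "vanishes p b (length \<Lambda> - 1 - k)"
        using vanishes_exp_diff[OF smp, of b "m - 1 - k" \<mu>] mk by (simp add: len)
    qed
    moreover have "exp_diff \<mu> p = (\<lambda>x. (if k = 0 then 0 else q (k - 1) x) + c * q k x)"
      by (auto simp: dp Q_def)
    ultimately show ?thesis
      using True by (intro exI[of _ p] exI[of _ c]) (simp add: len)
  qed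
qed

lemma bernstein_elem_basis:
  assumes "a < b" "k < length \<Lambda>"
  shows "bernstein_elem a b \<Lambda> k (bernstein_basis a b \<Lambda> k)"
  using assms(2)
proof (induction \<Lambda> arbitrary: k)
  case (Cons \<mu> \<Lambda>)
  then obtain p where "bernstein_elem a b (\<mu> # \<Lambda>) k p"
    using bernstein_elem_step[OF assms(1), of \<mu> "\<mu> # \<Lambda>" k "bernstein_basis a b \<Lambda>"] by auto
  then show ?case
    using bernstein_basis_eq[OF assms(1) Cons.prems] by simp
qed simp

section \<open>Derivatives and linear independence of the basis functions\<close>

lemma bernstein_basis_smooth: "a < b \<Longrightarrow> k < length \<Lambda> \<Longrightarrow> smooth_fun (bernstein_basis a b \<Lambda> k)"
  using bernstein_elem_basis[of a b k \<Lambda>] by (auto simp: bernstein_elem_def intro: exp_space_smooth)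

text \<open>Uniqueness identifies the basis with the constructed functions, and the unnamed constant
  of the construction is recovered as the limit in \<open>bernstein_d\<close>.\<close>

lemma bernstein_basis_exp_diff:
  fixes \<Lambda> :: "real list" and \<mu> :: real
  defines "\<Lambda>' \<equiv> remove1 \<mu> \<Lambda>"
  assumes ab: "a < b" and \<mu>: "\<mu> \<in> set \<Lambda>" and k: "k < length \<Lambda>"
  shows "exp_diff \<mu> (bernstein_basis a b \<Lambda> k) =
    (\<lambda>x. (if k = 0 then 0 else bernstein_basis a b \<Lambda>' (k - 1) x) +
      (if Suc k < length \<Lambda> then bernstein_d a b \<Lambda> k \<mu> * bernstein_basis a b \<Lambda>' k x else 0))"
proof -
  let ?p = "bernstein_basis a b \<Lambda> k" and ?q = "bernstein_basis a b \<Lambda>'"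
  have len: "length \<Lambda>' = length \<Lambda> - 1"
    using \<mu> by (simp add: \<Lambda>'_def length_remove1)
  have q: "bernstein_elem a b \<Lambda>' i (?q i)" if "Suc i < length \<Lambda>" for i
    using that len by (intro bernstein_elem_basis ab) simp
  obtain p c where p: "bernstein_elem a b \<Lambda> k p" and c: "exp_diff \<mu> p =
      (\<lambda>x. (if k = 0 then 0 else ?q (k - 1) x) + (if Suc k < length \<Lambda> then c * ?q k x else 0))"
    using bernstein_elem_step[OF ab \<mu> k, folded \<Lambda>'_def, of ?q, OF q] by blast
  have p_eq: "?p = p"
    by (rule bernstein_basis_eq[OF ab k p])
  have "bernstein_d a b \<Lambda> k \<mu> = c" if k': "Suc k < length \<Lambda>"
  proof -
    \<comment> \<open>The order of \<open>?q k\<close> at \<open>b\<close>. There \<open>p\<close>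
      and, for \<open>k > 0\<close>, \<open>?q (k - 1)\<close> have order \<open>r + 1\<close>, so
      their quotients by \<open>?q k\<close> tend to 0.\<close>
    define r where "r = length \<Lambda> - 2 - k"
    have r: "length \<Lambda> - Suc k = Suc r" "length \<Lambda>' - Suc k = r"
      using k' len by (auto simp: r_def)
    have sp: "smooth_fun p" "vanishes p b (Suc r)"
      using p by (auto simp: bernstein_elem_def zero_of_order_conv r intro: exp_space_smooth)
    have sq: "smooth_fun (?q k)" "zero_of_order (?q k) b r"
      using q[OF k'] by (auto simp: bernstein_elem_def r intro: exp_space_smooth)
    define Q where "Q = (if k = 0 then (\<lambda>_. 0) else ?q (k - 1))"
    have sQ: "smooth_fun Q" "vanishes Q b (Suc r)"
      using q[of "k - 1"] k' r len
      by (auto simp: Q_def bernstein_elem_def zero_of_order_conv smooth_fun_zero vanishes_zero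
          intro: exp_space_smooth)
    have "((\<lambda>x. of_real \<mu> * (p x / ?q k x) + Q x / ?q k x + c) \<longlongrightarrow> of_real \<mu> * 0 + 0 + c) (at b)"
      by (intro tendsto_add tendsto_mult tendsto_const zero_of_order_ratio(1)[OF sp sq]
          zero_of_order_ratio(1)[OF sQ sq])
    then have "((\<lambda>x. vderiv p x / ?q k x) \<longlongrightarrow> of_real \<mu> * 0 + 0 + c) (at b)"
    proof (rule Lim_transform_eventually)
      show "\<forall>\<^sub>F x in at b. of_real \<mu> * (p x / ?q k x) + Q x / ?q k x + c = vderiv p x / ?q k x"
        using zero_of_order_ratio(2)[OF sp sq]
        by eventually_elim
          (use k' in \<open>simp add: vderiv_eq_exp_diff[of p _ \<mu>] c Q_def add_divide_distrib\<close>)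
    qed
    then have "((\<lambda>x. vderiv p x / ?q k x) \<longlongrightarrow> c) (at_left b)"
      by (auto intro: tendsto_mono[OF at_le])
    then show ?thesis
      unfolding bernstein_d_def \<Lambda>'_def[symmetric] p_eq
      by (intro tendsto_Lim) simp_all
  qed
  then show ?thesis
    unfolding p_eq c by auto
qed

text \<open>Zeros throughout the open interval make the combination vanish on the whole line by zero
  counting. Its derivatives at \<open>a\<close> then give a triangular system with unit diagonal,
  solved by strong induction on \<open>k\<close>.\<close>

lemma bernstein_basis_independent:
  assumes ab: "a < b" and zero: "\<And>x. a < x \<Longrightarrow> x < b \<Longrightarrow>
      (\<Sum>k<length \<Lambda>. \<beta> k * bernstein_basis a b \<Lambda> k x) = 0"
    and k: "k < length \<Lambda>"
  shows "\<beta> k = 0"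
proof -
  let ?p = "bernstein_basis a b \<Lambda>"
  let ?S = "\<lambda>x. \<Sum>k<length \<Lambda>. \<beta> k * ?p k x"
  have p: "?p i \<in> exp_space \<Lambda>" "vanishes (?p i) a i" "(vderiv ^^ i) (?p i) a = 1"
    "smooth_fun (?p i)" if "i < length \<Lambda>" for i
    using bernstein_elem_basis[OF ab that]
    by (auto simp: bernstein_elem_def zero_of_order_conv intro: exp_space_smooth)
  obtain Z where Z: "finite Z" "card Z = length \<Lambda>" "Z \<subseteq> {a<..<b}"
    using infinite_arbitrarily_large[OF infinite_Ioo[OF ab]] by metis
  have "?S = (\<lambda>_. 0)"
  proof (rule exp_space_zeros[of _ \<Lambda> a b 0 0 Z])
    show "?S \<in> exp_space \<Lambda>"
      by (intro exp_space_sum exp_space_cmult p) simp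
  qed (use ab Z zero in auto)
  then have der0: "(\<Sum>i<length \<Lambda>. \<beta> i * (vderiv ^^ l) (?p i) a) = 0" for l
    using vderiv_pow_sum[of "{..<length \<Lambda>}" "\<lambda>k x. \<beta> k * ?p k x" l]
    by (simp add: smooth_fun_cmult p vderiv_pow_cmult vderiv_pow_zero fun_eq_iff)
  show ?thesis
    using k
  proof (induction k rule: less_induct)
    case (less k)
    have "\<beta> i * (vderiv ^^ k) (?p i) a = (if i = k then \<beta> k else 0)" if "i < length \<Lambda>" for i
      using less.IH[of i] p[OF that] that by (cases i k rule: linorder_cases) (auto simp: vanishes_def)
    then have "(\<Sum>i<length \<Lambda>. \<beta> i * (vderiv ^^ k) (?p i) a) = \<beta> k"
      using less.prems by simp
    with der0 show ?case by simp
  qed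
qed

text \<open>Each \<open>p k\<close> contributes \<open>q (k - 1)\<close> and a multiple of
  \<open>q k\<close>; the former is absent at \<open>k = 0\<close>, the latter at
  \<open>k = n\<close>. An index shift collects both into sums over \<open>k < n\<close>.\<close>

lemma exp_diff_bernstein_op:
  fixes \<Lambda> :: "real list" and \<mu> :: real
  assumes ab: "a < b" and \<mu>: "\<mu> \<in> set \<Lambda>" and len: "length \<Lambda> = Suc n"
  shows "exp_diff \<mu> (bernstein_op a b \<Lambda> t \<alpha> f) x =
    (\<Sum>k<n. (of_real (\<alpha> k) * f (t k) * bernstein_d a b \<Lambda> k \<mu> + of_real (\<alpha> (Suc k)) * f (t (Suc k)))
      * bernstein_basis a b (remove1 \<mu> \<Lambda>) k x)"
proof -
  let ?p = "bernstein_basis a b \<Lambda>" and ?q = "bernstein_basis a b (remove1 \<mu> \<Lambda>)"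
  let ?d = "\<lambda>k. bernstein_d a b \<Lambda> k \<mu>"
  let ?w = "\<lambda>k. of_real (\<alpha> k) * f (t k)"
  have sm: "smooth_fun (?p k)" if "k < Suc n" for k
    using that ab by (intro bernstein_basis_smooth) (simp_all add: len)
  have "exp_diff \<mu> (bernstein_op a b \<Lambda> t \<alpha> f) x = (\<Sum>k<Suc n. ?w k * exp_diff \<mu> (?p k) x)"
    unfolding bernstein_op_def len
    by (subst exp_diff_sum) (auto intro: smooth_fun_cmult sm simp: exp_diff_cmult sm)
  also have "\<dots> = (\<Sum>k<Suc n. ?w k * (if k = 0 then 0 else ?q (k - 1) x)) +
      (\<Sum>k<Suc n. ?w k * (if k < n then ?d k * ?q k x else 0))"
    unfolding sum.distrib[symmetric]
    by (intro sum.cong refl)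
       (simp add: bernstein_basis_exp_diff[OF ab \<mu>] len distrib_left)
  also have "(\<Sum>k<Suc n. ?w k * (if k = 0 then 0 else ?q (k - 1) x)) =
      (\<Sum>k<n. ?w (Suc k) * ?q k x)"
    by (subst sum.lessThan_Suc_shift) simp
  also have "(\<Sum>k<Suc n. ?w k * (if k < n then ?d k * ?q k x else 0)) =
      (\<Sum>k<n. ?w k * ?d k * ?q k x)"
    by (simp add: mult.assoc)
  finally show ?thesis
    by (simp add: sum.distrib algebra_simps)
qed

theorem theorem30:
  fixes n j :: nat and a b :: real and \<Lambda> :: "real list"
    and t \<alpha> :: "nat \<Rightarrow> real" and f :: "real \<Rightarrow> complex" and x :: real
  assumes "n \<ge> 1" and "a < b" and "length \<Lambda> = n + 1"
    and "\<Lambda> ! 0 = 0" and "\<Lambda> ! 0 \<noteq> \<Lambda> ! 1"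
    and "bernstein_knots_coeffs a b \<Lambda> t \<alpha>"
    and "j \<le> n" and "continuous_on {a..b} f"
  shows "exp_diff (\<Lambda> ! j) (bernstein_op a b \<Lambda> t \<alpha> f) x =
    (\<Sum>k<n. bernstein_Delta a b \<Lambda> (\<Lambda> ! j) t f k * of_real (\<alpha> k)
            * bernstein_basis a b (remove1 (\<Lambda> ! j) \<Lambda>) k x)"
proof -
  have len: "length \<Lambda> = Suc n" using assms(3) by simp
  have mem: "\<Lambda> ! i \<in> set \<Lambda>" if "i \<le> n" for i
    using that len by simp
  have mem0: "0 \<in> set \<Lambda>" using mem[of 0] assms(4) by simp
  let ?B1 = "bernstein_op a b \<Lambda> t \<alpha> (\<lambda>_. 1)"
  \<comment> \<open>Since \<open>\<Lambda> ! 0\<close> is 0, reproducing its exponential means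
    reproducing the constant 1.\<close>
  have B1: "?B1 y = 1" if "a < y" "y < b" for y
    using assms(6) that assms(4) unfolding bernstein_knots_coeffs_def by auto
  \<comment> \<open>Reproduction is given on the closed interval only, so the derivative is computed
    at interior points; these suffice for linear independence.\<close>
  have B1': "exp_diff 0 ?B1 y = 0" if y: "a < y" "y < b" for y
  proof -
    have "(?B1 has_vector_derivative 0) (at y)"
      by (rule has_vector_derivative_transform_within_open[of "\<lambda>_. 1" _ _ "{a<..<b}"])
         (use y B1 in auto)
    then show ?thesis
      by (simp add: exp_diff_def vderiv_def vector_derivative_at)
  qed
  \<comment> \<open>Comparison of coefficients in \<open>D (B 1) = 0\<close> on the open
    interval.\<close>
  have rec: "of_real (\<alpha> (Suc k)) = - of_real (\<alpha> k) * bernstein_d a b \<Lambda> k 0" if "k < n" for k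
  proof -
    have "of_real (\<alpha> k) * bernstein_d a b \<Lambda> k 0 + of_real (\<alpha> (Suc k)) = 0"
    proof (rule bernstein_basis_independent[OF assms(2), where \<Lambda> = "remove1 0 \<Lambda>"
          and \<beta> = "\<lambda>k. of_real (\<alpha> k) * bernstein_d a b \<Lambda> k 0 + of_real (\<alpha> (Suc k))"])
      show "k < length (remove1 0 \<Lambda>)"
        using that len mem0 by (simp add: length_remove1)
    next
      fix y assume "a < y" "y < b"
      then show "(\<Sum>k<length (remove1 0 \<Lambda>). (of_real (\<alpha> k) * bernstein_d a b \<Lambda> k 0
          + of_real (\<alpha> (Suc k))) * bernstein_basis a b (remove1 0 \<Lambda>) k y) = 0"
        using exp_diff_bernstein_op[OF assms(2) mem0 len, of t \<alpha> "\<lambda>_. 1" y] B1' len mem0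
        by (simp add: length_remove1)
    qed
    then show ?thesis by (simp add: add_eq_0_iff2)
  qed
  \<comment> \<open>The recursion replaces \<open>\<alpha> (k + 1)\<close> by
    \<open>- \<alpha> k * bernstein_d a b \<Lambda> k 0\<close>, which produces the second term of
    \<open>bernstein_Delta\<close>.\<close>
  show ?thesis
    unfolding exp_diff_bernstein_op[OF assms(2) mem[OF assms(7)] len]
    by (intro sum.cong refl) (simp add: bernstein_Delta_def assms(4) rec algebra_simps)
qed

end
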